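(* Let $r$ be a positive integer. For every integer $n\geq1$ and every real $z\neq1$, \[\det\left(\frac{\partial^{i+j-2}}{\partial z^{i+j-2}}\left(\frac{e^{z}}{(1-z)^{r}}\right)\right)_{1\leq i,j\leq n}=\left(\frac{e^{z}}{(1-z)^{r}}\right)^{n}\frac{r^{\overline{n-1}}\prod_{k=1}^{n-1}r^{\overline{k-1}}\,k!}{(z-1)^{(n-1)n}},\] where $r^{\overline{k}}=r(r+1)\cdots(r+k-1)$ and $r^{\overline{0}}=1$. *)

theory Defs
  imports "HOL-Analysis.Derivative" "Jordan_Normal_Form.Determinant"
begin

end

theory Submission imports Defs begin

text \<open>
  Let \<open>u = 1 / (1 - z)\<close> and \<open>f(z) = e\<^sup>z u\<^sup>r\<close>. By Leibniz, \<open>f\<^sup>(\<^sup>m\<^sup>)(z) / f(z)\<close> is the binomial transform of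
  the sequence of rising factorials \<open>r(r+1)\<dots>(r+k-1)\<close> times \<open>u\<^sup>k\<close>. Hankel determinants are invariant
  under this transform, and the Chu--Vandermonde identity yields an LU decomposition
  of the Hankel matrix of the rising factorials.
\<close>

definition binomial_transform :: "(nat \<Rightarrow> 'a::comm_semiring_1) \<Rightarrow> nat \<Rightarrow> 'a" where
  "binomial_transform c m = (\<Sum>k\<le>m. of_nat (m choose k) * c k)"

lemma binomial_transform_0 [simp]: "binomial_transform c 0 = c 0"
  by (simp add: binomial_transform_def)

text \<open>Pascal's rule splits \<open>Suc m choose Suc k\<close>. The result is a recursion in
  \<open>m\<close> whose second term is the transform of the shifted sequence.\<close>

lemma binomial_transform_Suc:
  "binomial_transform c (Suc m) = binomial_transform c m + binomial_transform (\<lambda>k. c (Suc k)) m"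
proof -
  have "binomial_transform c (Suc m) =
      c 0 + (\<Sum>k\<le>m. of_nat (m choose Suc k) * c (Suc k)) + binomial_transform (\<lambda>k. c (Suc k)) m"
    by (simp add: binomial_transform_def sum.atMost_Suc_shift algebra_simps sum.distrib
        del: sum.atMost_Suc)
  also have "c 0 + (\<Sum>k\<le>m. of_nat (m choose Suc k) * c (Suc k)) =
      (\<Sum>k\<le>Suc m. of_nat (m choose k) * c k)"
    by (subst sum.atMost_Suc_shift) simp
  also have "\<dots> = binomial_transform c m"
    by (simp add: binomial_transform_def binomial_eq_0)
  finally show ?thesis .
qed

text \<open>With \<open>E\<close> the shift of sequences, the transform at \<open>m\<close> is the
  entry at index 0 of \<open>(1 + E)^m\<close> applied to \<open>c\<close>, and
  \<open>(1 + E)^(i + j)\<close> factors. The double sum has the shape of a triple matrix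
  product.\<close>

lemma binomial_transform_plus:
  "binomial_transform c (i + j) =
    binomial_transform (\<lambda>k. binomial_transform (\<lambda>l. c (k + l)) j) i"
proof (induction i arbitrary: c)
  case (Suc i)
  then show ?case
    by (simp add: binomial_transform_Suc[of _ "i + j"]) (simp add: binomial_transform_Suc)
qed simp

text \<open>A summation range independent of \<open>i\<close> turns transforms into rows of an
  \<open>n\<close> by \<open>n\<close> matrix product.\<close>

lemma binomial_transform_atMost_extend:
  assumes "i < n"
  shows "binomial_transform c i = (\<Sum>k<n. of_nat (i choose k) * c k)"
  unfolding binomial_transform_def
  by (rule sum.mono_neutral_left) (use assms in \<open>auto simp: binomial_eq_0\<close>)

lemma prod_list_diag_mat:
  "prod_list (diag_mat (mat n n g)) = (\<Prod>i<n. g (i, i))"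
proof -
  have "diag_mat (mat n n g) = map (\<lambda>i. g (i, i)) [0..<n]"
    by (auto simp: diag_mat_def)
  then show ?thesis
    by (simp add: prod.distinct_set_conv_list[symmetric] atLeast0LessThan)
qed

lemma det_mat_lower_times_upper:
  fixes L M :: "nat \<Rightarrow> nat \<Rightarrow> 'a::idom"
  assumes L: "\<And>i k. i < k \<Longrightarrow> L i k = 0" and M: "\<And>k j. j < k \<Longrightarrow> M k j = 0"
  shows "det (mat n n (\<lambda>(i, j). \<Sum>k<n. L i k * M k j)) = (\<Prod>i<n. L i i * M i i)"
proof -
  have "mat n n (\<lambda>(i, j). \<Sum>k<n. L i k * M k j) =
      mat n n (\<lambda>(i, k). L i k) * mat n n (\<lambda>(k, j). M k j)"
    by (rule eq_matI) (auto simp: scalar_prod_def atLeast0LessThan)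
  moreover have "det (mat n n (\<lambda>(i, k). L i k)) = (\<Prod>i<n. L i i)"
    by (subst det_lower_triangular[where n = n]) (auto simp: L prod_list_diag_mat)
  moreover have "det (mat n n (\<lambda>(k, j). M k j)) = (\<Prod>i<n. M i i)"
    by (subst det_upper_triangular[where n = n]) (auto simp: M prod_list_diag_mat)
  ultimately show ?thesis
    by (simp add: det_mult[where n = n] prod.distrib)
qed

text \<open>The transformed Hankel matrix is \<open>B * H * B^T\<close>, where \<open>B\<close> is
  the Pascal matrix: lower triangular with unit diagonal, hence of determinant 1.\<close>

lemma det_Hankel_binomial_transform:
  fixes c :: "nat \<Rightarrow> 'a::idom"
  shows "det (mat n n (\<lambda>(i, j). binomial_transform c (i + j))) = det (mat n n (\<lambda>(i, j). c (i + j)))"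
proof -
  define B :: "'a mat" where "B = mat n n (\<lambda>(i, k). of_nat (i choose k))"
  define H where "H = mat n n (\<lambda>(i, j). c (i + j))"
  have car: "B \<in> carrier_mat n n" "H \<in> carrier_mat n n"
    by (auto simp: B_def H_def)
  have "mat n n (\<lambda>(i, j). binomial_transform c (i + j)) = B * (H * transpose_mat B)"
    by (rule eq_matI)
      (auto simp: B_def H_def scalar_prod_def atLeast0LessThan binomial_transform_plus
        binomial_transform_atMost_extend[of _ n] mult.commute intro!: sum.cong)
  moreover have "det B = 1"
    by (subst det_lower_triangular[where n = n]) (auto simp: B_def prod_list_diag_mat binomial_eq_0)
  ultimately show ?thesis
    using car by (simp add: det_mult[where n = n] det_transpose[of _ n] flip: H_def)
qed

text \<open>Chu-Vandermonde for the upper argument \<open>i + (a + j - 1)\<close>. The expansion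
  separates the indices: \<open>i\<close> enters only through \<open>i choose k\<close>, and the
  other factor depends on \<open>k\<close> and \<open>j\<close> alone, as an LU factorization
  requires.\<close>

lemma pochhammer_add_eq_sum:
  fixes a :: "'a::field_char_0"
  shows "pochhammer (a + of_nat i) j =
    (\<Sum>k\<le>j. of_nat (i choose k) * (fact j / fact (j - k) * pochhammer (a + of_nat k) (j - k)))"
proof -
  have "pochhammer (a + of_nat i) j = fact j * ((of_nat i + (a + of_nat j - 1)) gchoose j)"
    by (simp add: gbinomial_pochhammer' algebra_simps)
  also have "\<dots> = fact j * (\<Sum>k\<le>j. (of_nat i gchoose k) * ((a + of_nat j - 1) gchoose (j - k)))"
    by (simp add: gbinomial_Vandermonde flip: atLeast0AtMost)
  also have "\<dots> = (\<Sum>k\<le>j. of_nat (i choose k) *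
      (fact j / fact (j - k) * pochhammer (a + of_nat k) (j - k)))"
    unfolding sum_distrib_left
    by (rule sum.cong) (auto simp: gbinomial_pochhammer'[of "a + of_nat j - 1"] of_nat_diff
        binomial_gbinomial algebra_simps)
  finally show ?thesis .
qed

text \<open>Split \<open>pochhammer a (i + j)\<close> as
  \<open>pochhammer a i * pochhammer (a + i) j\<close> and expand the second factor by
  Chu-Vandermonde. In the resulting LU factorization the diagonal entries are
  \<open>u^i * pochhammer a i\<close> and \<open>u^i * fact i\<close>.\<close>

lemma det_Hankel_pochhammer:
  fixes a u :: "'a::field_char_0"
  shows "det (mat n n (\<lambda>(i, j). pochhammer a (i + j) * u ^ (i + j))) =
    (\<Prod>i<n. pochhammer a i * fact i * u ^ (2 * i))"
proof -
  define L where "L i k = u ^ i * pochhammer a i * of_nat (i choose k)" for i k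
  \<comment> \<open>The case distinction makes \<open>M\<close> upper triangular: for
    \<open>k > j\<close> the truncated \<open>j - k\<close> is 0 and the formula alone would give
    \<open>u^j * fact j\<close>.\<close>
  define M where "M k j = (if k \<le> j then
      u ^ j * (fact j / fact (j - k) * pochhammer (a + of_nat k) (j - k)) else 0)" for k j
  have "pochhammer a (i + j) * u ^ (i + j) = (\<Sum>k<n. L i k * M k j)" if "j < n" for i j
  proof -
    have "(\<Sum>k<n. L i k * M k j) = (\<Sum>k\<le>j. L i k * M k j)"
      by (rule sum.mono_neutral_right) (use that in \<open>auto simp: M_def\<close>)
    also have "\<dots> = u ^ i * pochhammer a i * (u ^ j * pochhammer (a + of_nat i) j)"
      unfolding pochhammer_add_eq_sum[of a i j] sum_distrib_left
      by (rule sum.cong) (auto simp: L_def M_def)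
    finally show ?thesis
      by (simp add: pochhammer_product' power_add)
  qed
  then have "mat n n (\<lambda>(i, j). pochhammer a (i + j) * u ^ (i + j)) =
      mat n n (\<lambda>(i, j). \<Sum>k<n. L i k * M k j)"
    by (intro eq_matI) auto
  also have "det \<dots> = (\<Prod>i<n. L i i * M i i)"
    by (rule det_mat_lower_times_upper) (auto simp: L_def M_def binomial_eq_0)
  finally show ?thesis
    by (simp add: L_def M_def power2_eq_square power_mult power_mult_distrib algebra_simps)
qed

text \<open>Differentiating the power brings down the factor \<open>r + k\<close>, which is exactly
  what extends the rising factorial by one step. So differentiation acts as the index shift.\<close>

lemma has_real_derivative_pochhammer_over_power:
  fixes x :: real
  assumes "x \<noteq> 1"
  shows "((\<lambda>x. pochhammer (real r) k / (1 - x) ^ (r + k)) has_real_derivative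
    pochhammer (real r) (Suc k) / (1 - x) ^ (r + Suc k)) (at x)"
proof -
  have inv: "((\<lambda>x. 1 / (1 - x)) has_real_derivative (1 / (1 - x)) ^ 2) (at x)"
    using assms by (auto intro!: derivative_eq_intros simp: power2_eq_square)
  have "((\<lambda>x. (1 / (1 - x)) ^ N) has_real_derivative real N * (1 / (1 - x)) ^ Suc N) (at x)" for N
    \<comment> \<open>The power rule produces the exponent \<open>N - 1\<close> in truncated
      subtraction, so \<open>N = 0\<close> is treated apart.\<close>
    by (rule DERIV_cong[OF DERIV_power[OF inv]]) (cases N; simp add: power2_eq_square)
  from DERIV_cmult[OF this, of "pochhammer (real r) k" "r + k"] show ?thesis
    by (simp add: pochhammer_Suc power_one_over mult.assoc)
qed

text \<open>In the induction step the product rule yields the transform of the sequence plus that of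
  its shift, which is the Pascal recursion for \<open>Suc m\<close>.\<close>

lemma higher_deriv_exp_over_power:
  fixes x :: real
  assumes "x \<noteq> 1"
  shows "(deriv ^^ m) (\<lambda>x. exp x / (1 - x) ^ r) x =
    exp x * binomial_transform (\<lambda>k. pochhammer (real r) k / (1 - x) ^ (r + k)) m"
  using assms
proof (induction m arbitrary: x)
  case (Suc m)
  let ?c = "\<lambda>x k. pochhammer (real r) k / (1 - x) ^ (r + k)"
  have "((\<lambda>y. exp y * binomial_transform (?c y) m) has_real_derivative
      exp x * binomial_transform (?c x) m + exp x * binomial_transform (\<lambda>k. ?c x (Suc k)) m) (at x)"
    unfolding binomial_transform_def
    by (rule derivative_eq_intros refl has_real_derivative_pochhammer_over_power Suc.prems)+
      (simp add: algebra_simps)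
  \<comment> \<open>The induction hypothesis holds only away from 1. Differentiating it needs
    equality on a neighbourhood of \<open>x\<close>, which the open complement of \<open>{1}\<close>
    provides.\<close>
  moreover have "eventually (\<lambda>y. y \<in> - {1}) (nhds x)"
    using Suc.prems by (intro eventually_nhds_in_open) auto
  then have "eventually (\<lambda>y. (deriv ^^ m) (\<lambda>x. exp x / (1 - x) ^ r) y =
      exp y * binomial_transform (?c y) m) (nhds x)"
    by eventually_elim (simp add: Suc.IH)
  then have "deriv ((deriv ^^ m) (\<lambda>x. exp x / (1 - x) ^ r)) x =
      deriv (\<lambda>y. exp y * binomial_transform (?c y) m) x"
    by (intro deriv_cong_ev) auto
  ultimately show ?case
    by (simp add: DERIV_imp_deriv binomial_transform_Suc distrib_left)
qed simp

theorem theorem13: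
  fixes r n :: nat and z :: real
  assumes "r \<ge> 1" and "n \<ge> 1" and "z \<noteq> 1"
  shows "det (mat n n (\<lambda>(i, j). (deriv ^^ (i + j)) (\<lambda>x::real. exp x / (1 - x) ^ r) z)) =
    (exp z / (1 - z) ^ r) ^ n *
      (pochhammer (real r) (n - 1) * (\<Prod>k = 1..n - 1. pochhammer (real r) (k - 1) * fact k)
        / (z - 1) ^ ((n - 1) * n))"
proof -
  define u where "u = 1 / (1 - z)"
  \<comment> \<open>The constant power \<open>u^r\<close> is moved into \<open>f\<close>, so that
    \<open>f\<close> is a common scalar of all entries and contributes \<open>f^n\<close>.\<close>
  define c where "c k = pochhammer (real r) k * u ^ k" for k
  define f where "f = exp z / (1 - z) ^ r"
  have "(deriv ^^ m) (\<lambda>x::real. exp x / (1 - x) ^ r) z = f * binomial_transform c m" for m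
    using assms(3) unfolding binomial_transform_def
    by (simp add: higher_deriv_exp_over_power binomial_transform_def f_def c_def u_def
        power_add power_divide sum_distrib_left field_simps)
  then have "mat n n (\<lambda>(i, j). (deriv ^^ (i + j)) (\<lambda>x::real. exp x / (1 - x) ^ r) z) =
      f \<cdot>\<^sub>m mat n n (\<lambda>(i, j). binomial_transform c (i + j))"
    by (intro eq_matI) auto
  then have "det (mat n n (\<lambda>(i, j). (deriv ^^ (i + j)) (\<lambda>x::real. exp x / (1 - x) ^ r) z)) =
      f ^ n * (\<Prod>i<n. pochhammer (real r) i * fact i * u ^ (2 * i))"
    by (simp add: det_Hankel_binomial_transform det_Hankel_pochhammer c_def)
  \<comment> \<open>The right side pairs \<open>fact k\<close> with the rising factorial of index
    \<open>k - 1\<close>, which leaves the one of index \<open>n - 1\<close> in front. Induction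
    from \<open>n = 1\<close> regroups the factors; the exponents \<open>2 * i\<close> add up to
    \<open>(n - 1) * n\<close>.\<close>
  also have "(\<Prod>i<n. pochhammer (real r) i * fact i * u ^ (2 * i)) =
      pochhammer (real r) (n - 1) * (\<Prod>k = 1..n - 1. pochhammer (real r) (k - 1) * fact k)
        / (z - 1) ^ ((n - 1) * n)"
    using assms(2)
  proof (induction n rule: nat_induct_at_least)
    case (Suc n)
    then obtain m where m: "n = Suc m"
      by (cases n) auto
    \<comment> \<open>The even exponent absorbs the sign between \<open>1 - z\<close> and
      \<open>z - 1\<close>.\<close>
    have u: "u ^ (2 * n) = 1 / (z - 1) ^ (2 * n)"
      by (simp add: u_def power_mult power_divide power2_commute)
    have "(Suc n - 1) * Suc n = (n - 1) * n + 2 * n"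
      by (simp add: m)
    then have "(z - 1) ^ ((Suc n - 1) * Suc n) = (z - 1) ^ ((n - 1) * n) * (z - 1) ^ (2 * n)"
      by (simp only: power_add)
    moreover have "(\<Prod>k = 1..Suc n - 1. pochhammer (real r) (k - 1) * fact k) =
        (\<Prod>k = 1..n - 1. pochhammer (real r) (k - 1) * fact k) *
          (pochhammer (real r) (n - 1) * fact n)"
      by (simp add: m)
    ultimately show ?case
      by (simp only: prod.lessThan_Suc Suc.IH u) simp
  qed simp
  finally show ?thesis
    by (simp add: f_def)
qed

end
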